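(* Let $a \geq 0$. Let $X$ be a continuous nonnegative random variable, with finite first and second moments, whose density is decreasing over the interval $[(1/2)a,(3/2)a]$ and increasing over the interval $[-(3/2)a,-(1/2)a]$. Then $$\mathbb{P}(|X - \mu| \geq a) \leq \frac{1}{2}\cdot\frac{\operatorname{Var}(X)}{a^2}.$$
   Context: A continuous random variable is a real random variable whose distribution has a density with respect to Lebesgue measure. Here $\mu = \mathbb{E}[X]$ is the mean of $X$ and $\operatorname{Var}(X) = \mathbb{E}[(X-\mu)^2]$ is its variance.
   Formalization: The monotonicity is required of the density of X − μ, not of X: with X's own density the claim fails (a=1, X uniform on [2.9,3]∪[5,5.1]: probability 1, bound about 0.55). For a=0 the right side is read as +∞. *)

theory Defs
  imports "HOL-Probability.Probability"
begin

end

theory Submission imports Defs begin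

text \<open>
  For \<open>a = 0\<close> the right-hand side is infinite, because a random variable with a density is not
  almost surely constant and so has positive variance.

  Let \<open>a > 0\<close> and let \<open>g\<close> be the density of \<open>Y = X - \<mu>\<close>. The claim is that \<open>\<integral> g h \<ge> 0\<close>, where
  \<open>h y = y\<^sup>2 / 2 - a\<^sup>2 \<cdot> 1(\<bar>y\<bar> \<ge> a)\<close>. Chebyshev's inequality would use \<open>y\<^sup>2\<close> in place of \<open>y\<^sup>2 / 2\<close>;
  halving it makes \<open>h\<close> negative, but only for \<open>a \<le> \<bar>y\<bar> < sqrt 2 \<cdot> a\<close>. On \<open>{a/2..sqrt 2 * a}\<close>
  the function \<open>h\<close> changes sign once, from plus to minus, at the point \<open>a\<close>. As \<open>g\<close> decreases there
  (\<open>sqrt 2 \<le> 3/2\<close>), it is at least \<open>g a\<close> where \<open>h\<close> is positive and at most \<open>g a\<close> where \<open>h\<close> is negative, so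
  \<open>g h \<ge> g a \<cdot> h\<close> in both cases. The mirrored bound holds on the negative side, with \<open>g (- a)\<close>, and
  \<open>g h \<ge> 0\<close> everywhere else. It remains that \<open>h\<close> itself has positive integral over
  \<open>{a/2..sqrt 2 * a}\<close>: the gain over \<open>{a/2..<a}\<close> compensates the loss beyond \<open>a\<close>. This is
  \<open>half_square_excess_integral\<close>; the comparison is \<open>unimodal_half_square_excess\<close>.
\<close>

definition half_square_excess :: "real \<Rightarrow> real \<Rightarrow> real" where
  "half_square_excess a y = y\<^sup>2 / 2 - a\<^sup>2 * indicator {z. a \<le> \<bar>z\<bar>} y"

lemma half_square_excess_minus [simp]:
  "half_square_excess a (- y) = half_square_excess a y"
  by (simp add: half_square_excess_def indicator_def)

lemma half_square_excess_nonneg: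
  assumes "a \<ge> 0" and "\<bar>y\<bar> < a \<or> sqrt 2 * a \<le> \<bar>y\<bar>"
  shows "half_square_excess a y \<ge> 0"
proof (cases "\<bar>y\<bar> < a")
  case False
  then have "(sqrt 2 * a)\<^sup>2 \<le> \<bar>y\<bar>\<^sup>2"
    using assms by (intro power_mono) auto
  then show ?thesis
    by (simp add: half_square_excess_def indicator_def power_mult_distrib)
qed (simp add: half_square_excess_def indicator_def)

lemma half_square_excess_nonpos:
  assumes "a \<le> \<bar>y\<bar>" and "\<bar>y\<bar> \<le> sqrt 2 * a"
  shows "half_square_excess a y \<le> 0"
proof -
  have "\<bar>y\<bar>\<^sup>2 \<le> (sqrt 2 * a)\<^sup>2"
    using assms by (intro power_mono) auto
  then show ?thesis
    using assms by (simp add: half_square_excess_def indicator_def power_mult_distrib)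
qed

lemma sqrt2_bounds: "sqrt 2 \<le> 3/2" "sqrt 2 < 23/16"
  by (rule real_le_lsqrt real_less_lsqrt; simp add: power2_eq_square)+

text \<open>
  The integral is \<open>((2 * sqrt 2 - 1/8) / 6 - (sqrt 2 - 1)) * a ^ 3\<close>, whose coefficient equals
  \<open>47/48 - 2/3 * sqrt 2\<close>, which is about \<open>0.036\<close>;
  nonnegativity means \<open>sqrt 2 \<le> 47/32\<close>, and this follows from the bound \<open>23/16\<close>.
\<close>

lemma half_square_excess_integral:
  assumes "a > 0"
  defines "I \<equiv> {a/2..sqrt 2 * a}"
  shows "integrable lborel (\<lambda>y. indicator I y * half_square_excess a y)" (is ?int)
    and "0 \<le> (LBINT y. indicator I y * half_square_excess a y)" (is ?pos)
proof -
  have sq: "1 \<le> sqrt 2" by simp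
  have le: "a \<le> sqrt 2 * a" using assms(1) sq by simp
  have le': "a/2 \<le> sqrt 2 * a" using le assms(1) by linarith
  have ind: "indicator I y * half_square_excess a y
      = y ^ 2 * indicator I y / 2 - a\<^sup>2 * indicator {a..sqrt 2 * a} y" for y
    using assms(1) unfolding I_def half_square_excess_def
    by (auto simp: indicator_def)
  have i1: "integrable lborel (\<lambda>y. y ^ 2 * indicator I y :: real)"
    unfolding I_def by (intro borel_integrable_atLeastAtMost) auto
  have i2: "integrable lborel (\<lambda>y. a\<^sup>2 * indicator {a..sqrt 2 * a} y)"
    by (intro integrable_mult_right integrable_real_indicator) (simp_all add: le)
  show ?int
    unfolding ind using i1 i2 by (intro Bochner_Integration.integrable_diff) auto
  have "(LBINT y. y ^ 2 * indicator I y) = ((sqrt 2 * a) ^ 3 - (a/2) ^ 3) / 3"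
    unfolding I_def by (subst integral_power[OF le']) (simp add: eval_nat_numeral)
  then have "(LBINT y. indicator I y * half_square_excess a y)
      = ((sqrt 2 * a) ^ 3 - (a/2) ^ 3) / 6 - a\<^sup>2 * (sqrt 2 * a - a)"
    unfolding ind using i1 i2 le by (simp add: Bochner_Integration.integral_diff)
  also have "\<dots> = a ^ 3 * (47/48 - 2/3 * sqrt 2)"
    by (simp add: power_mult_distrib power3_eq_cube power2_eq_square field_simps)
  also have "\<dots> \<ge> 0"
    using assms(1) sqrt2_bounds(2) by (intro mult_nonneg_nonneg) auto
  finally show ?pos .
qed

text \<open>
  The single crossing of \<open>half_square_excess a\<close> and of \<open>g - g a\<close> at the same point \<open>a\<close> makes
  \<open>(g y - g a) * half_square_excess a y\<close> nonnegative on \<open>{a/2..sqrt 2 * a}\<close>.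
\<close>

lemma antimono_half_square_excess_ge:
  assumes "a > 0" and anti: "antimono_on {a/2..3/2 * a} g"
    and y: "a/2 \<le> y" "y \<le> sqrt 2 * a"
  shows "g a * half_square_excess a y \<le> g y * (half_square_excess a y :: real)"
proof -
  have "y \<le> 3/2 * a"
    using y(2)
    by (rule order_trans) (use assms(1) sqrt2_bounds(1) in \<open>intro mult_right_mono; simp\<close>)
  then have mem: "y \<in> {a/2..3/2 * a}" "a \<in> {a/2..3/2 * a}"
    using y(1) assms(1) by auto
  show ?thesis
  proof (cases "y < a")
    case True
    then have "g a \<le> g y" using monotone_onD[OF anti mem(1) mem(2)] by simp
    then show ?thesis
      using half_square_excess_nonneg[of a y] True y assms(1) by (intro mult_right_mono) auto
  next
    case False
    then have "g y \<le> g a" using monotone_onD[OF anti mem(2) mem(1)] by simp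
    then show ?thesis
      using half_square_excess_nonpos[of a y] False y assms(1) by (intro mult_right_mono_neg) auto
  qed
qed

lemma unimodal_half_square_excess:
  fixes g :: "real \<Rightarrow> real"
  assumes "a > 0" and nonneg: "\<And>y. g y \<ge> 0"
    and anti: "antimono_on {a/2..3/2 * a} g"
    and mono: "mono_on {- (3/2 * a)..- (a/2)} g"
    and int: "integrable lborel (\<lambda>y. g y * half_square_excess a y)"
  shows "0 \<le> (LBINT y. g y * half_square_excess a y)"
proof -
  define k where "k y = indicator {a/2..sqrt 2 * a} y * half_square_excess a y" for y
  have anti': "antimono_on {a/2..3/2 * a} (\<lambda>y. g (- y))"
    by (intro monotone_onI monotone_onD[OF mono]) auto
  have k: "integrable lborel k" "0 \<le> integral\<^sup>L lborel k"
    unfolding k_def using half_square_excess_integral[OF assms(1)] by auto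
  have k': "integrable lborel (\<lambda>y. k (- y))"
    using lborel_integrable_real_affine[OF k(1), of "-1" 0] by simp
  have refl: "(LBINT y. k (- y)) = integral\<^sup>L lborel k"
    using lborel_integral_real_affine[of "-1" k 0] by simp
  have bound: "g a * k y + g (- a) * k (- y) \<le> g y * half_square_excess a y" for y
  proof -
    consider "a/2 \<le> y" "y \<le> sqrt 2 * a" | "a/2 \<le> - y" "- y \<le> sqrt 2 * a"
      | "y \<notin> {a/2..sqrt 2 * a}" "- y \<notin> {a/2..sqrt 2 * a}" by fastforce
    then show ?thesis
    proof cases
      case 1
      then show ?thesis
        using antimono_half_square_excess_ge[OF assms(1) anti 1] assms(1)
        by (simp add: k_def)
    next
      case 2
      then show ?thesis
        using antimono_half_square_excess_ge[OF assms(1) anti' 2] assms(1)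
        by (simp add: k_def)
    next
      case 3
      then have "\<bar>y\<bar> < a \<or> sqrt 2 * a \<le> \<bar>y\<bar>"
        using assms(1) by auto
      then show ?thesis
        using 3 nonneg[of y] half_square_excess_nonneg[of a y] assms(1) by (simp add: k_def)
    qed
  qed
  have "0 \<le> g a * integral\<^sup>L lborel k + g (- a) * integral\<^sup>L lborel k"
    using nonneg k(2) by (intro add_nonneg_nonneg mult_nonneg_nonneg) auto
  also have "\<dots> = (LBINT y. g a * k y + g (- a) * k (- y))"
    using k(1) k' refl by simp
  also have "\<dots> \<le> (LBINT y. g y * half_square_excess a y)"
    using k(1) k' int bound by (intro integral_mono) auto
  finally show ?thesis .
qed

lemma (in prob_space) variance_pos_of_density:
  fixes X :: "'a \<Rightarrow> real"
  assumes dist: "distributed M lborel X (\<lambda>x. ennreal (f x))"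
    and int: "integrable M X" and int2: "integrable M (\<lambda>\<omega>. (X \<omega>)\<^sup>2)"
  shows "variance X > 0"
proof (rule ccontr)
  let ?\<mu> = "expectation X"
  assume "\<not> variance X > 0"
  moreover have "variance X \<ge> 0" by (intro integral_nonneg_AE) auto
  ultimately have "variance X = 0" by simp
  moreover have "integrable M (\<lambda>\<omega>. (X \<omega> - ?\<mu>)\<^sup>2)"
    using int int2 by (simp add: power2_diff)
  ultimately have "AE \<omega> in M. (X \<omega> - ?\<mu>)\<^sup>2 = 0"
    by (subst (asm) integral_nonneg_eq_0_iff_AE) auto
  then have "AE \<omega> in M. X \<omega> = ?\<mu>" by eventually_elim simp
  moreover have "AE \<omega> in M. X \<omega> \<noteq> ?\<mu>"
  proof -
    have "AE x in density lborel (\<lambda>x. ennreal (f x)). x \<noteq> ?\<mu>"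
      using distributed_borel_measurable[OF dist] AE_lborel_singleton[of ?\<mu>]
      by (subst AE_density) auto
    then have "AE x in distr M lborel X. x \<noteq> ?\<mu>"
      unfolding distributed_distr_eq_density[OF dist] .
    then show ?thesis
      using distributed_measurable[OF dist] by (subst (asm) AE_distr_iff) auto
  qed
  ultimately have "AE \<omega> in M. False" by eventually_elim simp
  then show False by simp
qed

theorem lemma10:
  fixes M :: "'a measure" and X :: "'a \<Rightarrow> real" and f :: "real \<Rightarrow> real" and a \<mu> :: real
  assumes "prob_space M"
    and "a \<ge> 0"
    and "distributed M lborel X (\<lambda>x. ennreal (f x))"
    and "\<And>x. f x \<ge> 0"
    and "AE \<omega> in M. X \<omega> \<ge> 0"
    and "integrable M X"
    and "integrable M (\<lambda>\<omega>. (X \<omega>)\<^sup>2)"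
    and "\<mu> = prob_space.expectation M X"
    and "antimono_on {(1/2) * a..(3/2) * a} (\<lambda>t. f (\<mu> + t))"
    and "mono_on {- ((3/2) * a)..- ((1/2) * a)} (\<lambda>t. f (\<mu> + t))"
  shows "ennreal (\<P>(\<omega> in M. \<bar>X \<omega> - \<mu>\<bar> \<ge> a))
           \<le> ennreal (1/2) * (ennreal (prob_space.variance M X) / ennreal (a\<^sup>2))"
proof (cases "a = 0")
  case True
  have "prob_space.variance M X > 0"
    using prob_space.variance_pos_of_density[OF assms(1,3,6,7)] .
  then have "ennreal (prob_space.variance M X) / ennreal (a\<^sup>2) = \<top>"
    using True by (simp add: ennreal_divide_zero)
  then show ?thesis by (simp add: ennreal_mult_top)
next
  case False
  interpret prob_space M by fact
  have a: "a > 0" using False assms(2) by simp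
  let ?h = "half_square_excess a"
  let ?A = "{\<omega> \<in> space M. a \<le> \<bar>X \<omega> - \<mu>\<bar>}"
  have X [measurable]: "X \<in> borel_measurable M"
    using assms(6) by auto
  have h [measurable]: "?h \<in> borel_measurable borel"
    unfolding half_square_excess_def by measurable
  have int_sq: "integrable M (\<lambda>\<omega>. (X \<omega> - \<mu>)\<^sup>2)"
    using assms(6,7) by (simp add: power2_diff)
  have h_X: "?h (X \<omega> - \<mu>) = (X \<omega> - \<mu>)\<^sup>2 / 2 - a\<^sup>2 * indicator ?A \<omega>" if "\<omega> \<in> space M" for \<omega>
    using that by (simp add: half_square_excess_def indicator_def)
  have int_A: "integrable M (\<lambda>\<omega>. a\<^sup>2 * indicator ?A \<omega>)"
    by (simp add: emeasure_eq_measure)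
  have int_h: "integrable M (\<lambda>\<omega>. ?h (X \<omega> - \<mu>))"
    using int_sq int_A h_X by (subst Bochner_Integration.integrable_cong[OF refl h_X]) auto
  have "(\<integral>\<omega>. ?h (X \<omega> - \<mu>) \<partial>M) = variance X / 2 - a\<^sup>2 * prob ?A"
  proof -
    have "(\<integral>\<omega>. ?h (X \<omega> - \<mu>) \<partial>M) = (\<integral>\<omega>. (X \<omega> - \<mu>)\<^sup>2 / 2 - a\<^sup>2 * indicator ?A \<omega> \<partial>M)"
      using h_X by (intro Bochner_Integration.integral_cong) auto
    also have "\<dots> = variance X / 2 - a\<^sup>2 * prob ?A"
      using int_sq int_A assms(8) by (subst Bochner_Integration.integral_diff) auto
    finally show ?thesis .
  qed
  moreover have "0 \<le> (\<integral>\<omega>. ?h (X \<omega> - \<mu>) \<partial>M)"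
  proof -
    have int_f: "integrable lborel (\<lambda>x. f x * ?h (x - \<mu>))"
      using int_h assms(4) by (subst distributed_integrable[OF assms(3)]) auto
    then have int_g: "integrable lborel (\<lambda>t. f (\<mu> + t) * ?h t)"
      using lborel_integrable_real_affine[OF int_f, of 1 \<mu>] by simp
    have "(\<integral>\<omega>. ?h (X \<omega> - \<mu>) \<partial>M) = (LBINT x. f x * ?h (x - \<mu>))"
      using assms(4) by (subst distributed_integral[OF assms(3), symmetric]) auto
    also have "\<dots> = (LBINT t. f (\<mu> + t) * ?h t)"
      using lborel_integral_real_affine[of 1 "\<lambda>x. f x * ?h (x - \<mu>)" \<mu>] by simp
    also have "\<dots> \<ge> 0"
      using a assms(4,9,10) int_g by (intro unimodal_half_square_excess) auto
    finally show ?thesis .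
  qed
  ultimately have "prob ?A \<le> 1/2 * (variance X / a\<^sup>2)"
    using a by (simp add: field_simps)
  then have "ennreal (prob ?A) \<le> ennreal (1/2 * (variance X / a\<^sup>2))"
    by (rule ennreal_leI)
  also have "\<dots> = ennreal (1/2) * (ennreal (variance X) / ennreal (a\<^sup>2))"
    using a by (subst ennreal_mult) (auto simp: divide_ennreal integral_nonneg_AE)
  finally show ?thesis .
qed

end
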